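(* Let $q$ be a parameter (an indeterminate over $\mathbb{C}$), and suppose that we are given a nontrivial algebraic nonlinear $q$-difference equation $$F(q,x,y(x),y(qx),\dots,y(q^nx))=0,$$ i.e. $F(q,x,w_0,\dots,w_n)\in\mathbb{C}[q,x,w_0,\dots,w_n]$ is not identically zero, with a formal solution $y(x)=\sum_{h\geq 0}y_hx^h\in\mathbb{C}(q)[[x]]$. Then there exist nonnegative numbers $s,s'$ such that $$\limsup_{h\to\infty}\frac{1}{h}\left(\deg_q y_h-s\frac{h(h-1)}{2}\right)<+\infty$$ and $$\limsup_{h\to\infty}\frac{1}{h}\left(\operatorname{ord}_q y_h-s'\frac{h(h-1)}{2}\right)>-\infty.$$
   Context: For $y(x)=\sum_{h\ge 0} y_hx^h\in\mathbb{C}(q)[[x]]$, the series $y(q^ix)$ is $\sum_{h\ge 0} q^{ih}y_hx^h$. For a nonzero polynomial $f\in\mathbb{C}[q]$, $\deg_q f$ is its degree in $q$ and $\operatorname{ord}_q f$ is its order of vanishing at $q=0$; both extend to nonzero elements of $\mathbb{C}(q)$ by $\deg_q(f/g)=\deg_q f-\deg_q g$ and $\operatorname{ord}_q(f/g)=\operatorname{ord}_q f-\operatorname{ord}_q g$, with the conventions $\deg_q 0=-\infty$ and $\operatorname{ord}_q 0=+\infty$.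
   Formalization: The second bound is proved with ord_q y_h + s' h(h-1)/2 in place of ord_q y_h - s' h(h-1)/2; as printed it fails for y(qx) = 1 + q x y(x), whose solution has y_h = q^{-h(h-1)/2}, for every s' ≥ 0. *)

theory Defs
  imports
    Complex_Main
    "HOL-Library.Poly_Mapping"
    "HOL-Library.Extended_Real"
    "HOL-Library.Liminf_Limsup"
    "HOL-Computational_Algebra.Computational_Algebra"
begin

type_synonym ratfun = "complex poly fract"

definition q_var :: ratfun where
  "q_var = Fraction_Field.Fract [:0, 1:] 1"

definition const_ratfun :: "complex \<Rightarrow> ratfun" where
  "const_ratfun c = Fraction_Field.Fract [:c:] 1"

(* A polynomial is a finitely supported map from exponent vectors to coefficients. *)

datatype qvar = Q | X | W nat

type_synonym qpoly = "(qvar \<Rightarrow>\<^sub>0 nat) \<Rightarrow>\<^sub>0 complex"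

definition qpoly_vars :: "qpoly \<Rightarrow> qvar set" where
  "qpoly_vars F = (\<Union>m\<in>Poly_Mapping.keys F. Poly_Mapping.keys m)"

definition qpoly_eval :: "(qvar \<Rightarrow> ratfun fps) \<Rightarrow> qpoly \<Rightarrow> ratfun fps" where
  "qpoly_eval \<rho> F =
     (\<Sum>m\<in>Poly_Mapping.keys F.
        fps_const (const_ratfun (Poly_Mapping.lookup F m)) *
        (\<Prod>v\<in>Poly_Mapping.keys m. \<rho> v ^ Poly_Mapping.lookup m v))"

definition q_shift :: "nat \<Rightarrow> ratfun fps \<Rightarrow> ratfun fps" where
  "q_shift i y = Abs_fps (\<lambda>h. q_var ^ (i * h) * fps_nth y h)"

fun q_assign :: "ratfun fps \<Rightarrow> qvar \<Rightarrow> ratfun fps" where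
  "q_assign y Q = fps_const q_var"
| "q_assign y X = fps_X"
| "q_assign y (W i) = q_shift i y"

(* The value is independent of the representation; see deg_q_Fract and ord_q_Fract. *)

definition deg_q :: "ratfun \<Rightarrow> ereal" where
  "deg_q r = (if r = 0 then - \<infinity> else
     (THE d. \<exists>f g. f \<noteq> 0 \<and> g \<noteq> 0 \<and> r = Fraction_Field.Fract f g \<and>
        d = ereal (real (degree f) - real (degree g))))"

(* order 0 f is the multiplicity of 0 as a root of f. *)
definition ord_q :: "ratfun \<Rightarrow> ereal" where
  "ord_q r = (if r = 0 then \<infinity> else
     (THE d. \<exists>f g. f \<noteq> 0 \<and> g \<noteq> 0 \<and> r = Fraction_Field.Fract f g \<and>
        d = ereal (real (order 0 f) - real (order 0 g))))"

lemma Fract_nonzero: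
  fixes f g :: "complex poly"
  shows "f \<noteq> 0 \<Longrightarrow> g \<noteq> 0 \<Longrightarrow> Fraction_Field.Fract f g \<noteq> 0"
  by (simp add: Zero_fract_def eq_fract)

lemma deg_q_Fract:
  assumes "f \<noteq> 0" "g \<noteq> 0"
  shows "deg_q (Fraction_Field.Fract f g) = ereal (real (degree f) - real (degree g))"
proof -
  have "real (degree a) - real (degree b) = real (degree f) - real (degree g)"
    if "a \<noteq> 0" "b \<noteq> 0" "Fraction_Field.Fract f g = Fraction_Field.Fract a b" for a b
  proof -
    have "f * b = a * g"
      using that assms by (simp add: eq_fract)
    then have "degree f + degree b = degree a + degree g"
      using that assms degree_mult_eq[of f b] degree_mult_eq[of a g] by simp
    then show ?thesis
      by linarith
  qed
  then show ?thesis
    using assms Fract_nonzero[OF assms] unfolding deg_q_def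
    by (simp only: if_False) (rule the_equality; blast)
qed

lemma ord_q_Fract:
  assumes "f \<noteq> 0" "g \<noteq> 0"
  shows "ord_q (Fraction_Field.Fract f g) = ereal (real (order 0 f) - real (order 0 g))"
proof -
  have "real (order 0 a) - real (order 0 b) = real (order 0 f) - real (order 0 g)"
    if "a \<noteq> 0" "b \<noteq> 0" "Fraction_Field.Fract f g = Fraction_Field.Fract a b" for a b
  proof -
    have "f * b = a * g"
      using that assms by (simp add: eq_fract)
    then have "order 0 f + order 0 b = order 0 a + order 0 g"
      using that assms order_mult[of f b 0] order_mult[of a g 0] by simp
    then show ?thesis
      by linarith
  qed
  then show ?thesis
    using assms Fract_nonzero[OF assms] unfolding ord_q_def
    by (simp only: if_False) (rule the_equality; blast)
qed

end

theory Submission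
  imports Defs
begin

text \<open>
  Among the equations satisfied by \<open>y\<close> there is one, \<open>G = 0\<close>, for which some series
  \<open>A i = (\<partial>G/\<partial>(W i))(y)\<close> is nonzero. Let \<open>v\<close> be the minimal \<open>x\<close>-order of the \<open>A i\<close>, and let \<open>p\<close> be
  the truncation of \<open>y\<close> to degrees below \<open>h > v\<close>. Taylor expansion turns \<open>G(y) = 0\<close> into
  \<open>P(q ^ h) * y\<^sub>h = - [x ^ (h + v)] G(p)\<close>, where the nonzero polynomial \<open>P\<close> has the coefficients
  \<open>[x ^ v] A i\<close>. For a valuation \<open>\<nu>\<close> (either \<open>deg_q\<close> or \<open>- ord_q\<close>), \<open>\<nu> (P(q ^ h))\<close> is bounded below
  linearly in \<open>h\<close>, and the right-hand side only involves products of \<open>y\<^sub>j\<close> with \<open>j < h\<close> and index sum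
  at most \<open>h + v\<close>. If \<open>\<nu> (y\<^sub>j) \<le> E + C * j\<^sup>2\<close> for \<open>j < h\<close>, convexity bounds such a product by
  \<open>C * ((h - 1)\<^sup>2 + (v + 1)\<^sup>2)\<close> plus a linear term, and the gain of about \<open>2 * C * h\<close> over \<open>C * h\<^sup>2\<close>
  absorbs all linear terms once \<open>C\<close> and \<open>h\<close> are large. So \<open>\<nu> (y\<^sub>h)\<close> grows at most quadratically.
\<close>

section \<open>Taylor expansion of multivariate polynomials\<close>

text \<open>Divisibility by \<open>d\<^sup>2\<close> replaces an explicit remainder: with
  \<open>d = fps_X ^ h\<close> it says that the quadratic error has no coefficients below degree
  2h.\<close>

lemma power_add_taylor:
  fixes a b d :: "'a::comm_ring_1"
  assumes "d dvd b"
  shows "d\<^sup>2 dvd (a + b) ^ k - a ^ k - of_nat k * a ^ (k - 1) * b"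
proof (induction k)
  case (Suc k)
  \<comment> \<open>At k = 0 the exponent truncates, but both sides carry the factor 0.\<close>
  have "of_nat k * a ^ k = of_nat k * a ^ (k - 1) * a"
    by (cases k) (simp_all add: mult_ac)
  then have "(a + b) ^ Suc k - a ^ Suc k - of_nat (Suc k) * a ^ (Suc k - 1) * b =
      (a + b) * ((a + b) ^ k - a ^ k - of_nat k * a ^ (k - 1) * b) + of_nat k * a ^ (k - 1) * b\<^sup>2"
    by (simp add: algebra_simps power2_eq_square)
  moreover have "d\<^sup>2 dvd b\<^sup>2"
    using assms by (simp add: dvd_power_same)
  ultimately show ?case
    using Suc by simp
qed simp

text \<open>The product rule, by induction on \<open>V\<close>. A truncated exponent at e v = 0 is
  harmless, because its term has the factor \<open>of_nat (e v)\<close>.\<close>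

lemma prod_power_add_taylor:
  fixes \<rho> \<sigma> :: "'v \<Rightarrow> 'a::comm_ring_1" and e :: "'v \<Rightarrow> nat"
  assumes "finite V" and "\<And>v. v \<in> V \<Longrightarrow> d dvd \<sigma> v"
  shows "d\<^sup>2 dvd (\<Prod>v\<in>V. (\<rho> v + \<sigma> v) ^ e v) - (\<Prod>v\<in>V. \<rho> v ^ e v) -
           (\<Sum>v\<in>V. \<sigma> v * of_nat (e v) * (\<Prod>u\<in>V. \<rho> u ^ (e u - (if u = v then 1 else 0))))"
  using assms
proof (induction V rule: finite_induct)
  case (insert x V)
  define D where
    "D = (\<Sum>v\<in>V. \<sigma> v * of_nat (e v) * (\<Prod>u\<in>V. \<rho> u ^ (e u - (if u = v then 1 else 0))))"
  define P P' where "P = (\<Prod>v\<in>V. \<rho> v ^ e v)" and "P' = (\<Prod>v\<in>V. (\<rho> v + \<sigma> v) ^ e v)"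
  define a a' \<delta> where "a = \<rho> x ^ e x" and "a' = (\<rho> x + \<sigma> x) ^ e x"
    and "\<delta> = of_nat (e x) * \<rho> x ^ (e x - 1) * \<sigma> x"
  have ne: "u \<noteq> x" if "u \<in> V" for u
    using that insert.hyps by auto
  have x_factor: "(\<Prod>u\<in>V. \<rho> u ^ (e u - (if u = x then 1 else 0))) = P"
    unfolding P_def by (rule prod.cong) (auto simp: ne)
  have "(\<Sum>v\<in>insert x V. \<sigma> v * of_nat (e v) *
          (\<Prod>u\<in>insert x V. \<rho> u ^ (e u - (if u = v then 1 else 0)))) = \<delta> * P + a * D"
  proof -
    have "\<sigma> v * of_nat (e v) * (\<Prod>u\<in>insert x V. \<rho> u ^ (e u - (if u = v then 1 else 0))) =
        a * (\<sigma> v * of_nat (e v) * (\<Prod>u\<in>V. \<rho> u ^ (e u - (if u = v then 1 else 0))))"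
      if "v \<in> V" for v
      using insert.hyps ne[OF that] by (auto simp: a_def mult_ac)
    then show ?thesis
      using insert.hyps by (simp add: x_factor D_def \<delta>_def sum_distrib_left mult_ac)
  qed
  moreover have "(\<Prod>v\<in>insert x V. (\<rho> v + \<sigma> v) ^ e v) = a' * P'"
    and "(\<Prod>v\<in>insert x V. \<rho> v ^ e v) = a * P"
    using insert.hyps by (simp_all add: P_def P'_def a_def a'_def)
  \<comment> \<open>The error splits into the second-order errors of the two factors and
    \<open>\<delta> * D\<close>, a product of two first-order terms; \<open>d\<^sup>2\<close>
    divides each.\<close>
  moreover have "a' * P' - a * P - (\<delta> * P + a * D) =
      a' * (P' - P - D) + (a' - a - \<delta>) * (P + D) + \<delta> * D"
    by (simp add: algebra_simps)
  moreover have "d\<^sup>2 dvd P' - P - D"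
    using insert unfolding P_def P'_def D_def by simp
  moreover have "d\<^sup>2 dvd a' - a - \<delta>"
    unfolding a_def a'_def \<delta>_def using insert.prems by (intro power_add_taylor) simp
  moreover have "d\<^sup>2 dvd \<delta> * D"
    unfolding power2_eq_square D_def \<delta>_def using insert.prems
    by (intro mult_dvd_mono dvd_sum) auto
  ultimately show ?case
    by simp
qed simp

section \<open>Evaluation and formal derivatives of polynomials\<close>

definition mon_eval :: "(qvar \<Rightarrow> ratfun fps) \<Rightarrow> (qvar \<Rightarrow>\<^sub>0 nat) \<Rightarrow> ratfun fps" where
  "mon_eval \<rho> m = (\<Prod>v\<in>Poly_Mapping.keys m. \<rho> v ^ Poly_Mapping.lookup m v)"

lemma mon_eval_superset:
  assumes "finite V" "Poly_Mapping.keys m \<subseteq> V"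
  shows "mon_eval \<rho> m = (\<Prod>v\<in>V. \<rho> v ^ Poly_Mapping.lookup m v)"
  unfolding mon_eval_def using assms
  by (intro prod.mono_neutral_left) (auto simp: in_keys_iff)

lemma const_ratfun_0: "const_ratfun 0 = 0"
  and const_ratfun_add: "const_ratfun (a + b) = const_ratfun a + const_ratfun b"
  and const_ratfun_mult: "const_ratfun (a * b) = const_ratfun a * const_ratfun b"
  by (simp_all add: const_ratfun_def Zero_fract_def mult.commute)

lemma const_ratfun_of_nat: "const_ratfun (of_nat k) = of_nat k"
  by (induction k)
     (simp_all add: const_ratfun_add const_ratfun_0, simp add: const_ratfun_def One_fract_def one_pCons)

text \<open>Monomials outside the support have coefficient 0. Over a common index set evaluation is
  visibly additive in the polynomial.\<close>

lemma qpoly_eval_superset: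
  assumes "finite S" "Poly_Mapping.keys F \<subseteq> S"
  shows "qpoly_eval \<rho> F = (\<Sum>m\<in>S. fps_const (const_ratfun (Poly_Mapping.lookup F m)) * mon_eval \<rho> m)"
  unfolding qpoly_eval_def mon_eval_def[symmetric] using assms
  by (intro sum.mono_neutral_left) (auto simp: in_keys_iff const_ratfun_0)

lemma qpoly_eval_add: "qpoly_eval \<rho> (F + G) = qpoly_eval \<rho> F + qpoly_eval \<rho> G"
proof -
  let ?S = "Poly_Mapping.keys F \<union> Poly_Mapping.keys G"
  have "Poly_Mapping.keys (F + G) \<subseteq> ?S"
    by (rule Poly_Mapping.keys_add)
  then show ?thesis
    by (simp add: qpoly_eval_superset[of ?S] lookup_add const_ratfun_add distrib_right sum.distrib
        flip: fps_const_add)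
qed

lemma qpoly_eval_0: "qpoly_eval \<rho> 0 = 0"
  by (simp add: qpoly_eval_def)

lemma qpoly_eval_sum: "qpoly_eval \<rho> (\<Sum>i\<in>I. F i) = (\<Sum>i\<in>I. qpoly_eval \<rho> (F i))"
  by (induction I rule: infinite_finite_induct) (simp_all add: qpoly_eval_0 qpoly_eval_add)

lemma qpoly_eval_single:
  "qpoly_eval \<rho> (Poly_Mapping.single m c) = fps_const (const_ratfun c) * mon_eval \<rho> m"
  by (subst qpoly_eval_superset[of "{m}"]) auto

text \<open>The formal partial derivative. If \<open>v\<close> does not occur in \<open>m\<close>,
  the exponent subtraction truncates, but the coefficient is 0.\<close>

definition qpoly_deriv :: "qvar \<Rightarrow> qpoly \<Rightarrow> qpoly" where
  "qpoly_deriv v F = (\<Sum>m\<in>Poly_Mapping.keys F.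
     Poly_Mapping.single (m - Poly_Mapping.single v 1)
       (Poly_Mapping.lookup F m * of_nat (Poly_Mapping.lookup m v)))"

lemma qpoly_eval_deriv:
  "qpoly_eval \<rho> (qpoly_deriv v F) = (\<Sum>m\<in>Poly_Mapping.keys F.
     fps_const (const_ratfun (Poly_Mapping.lookup F m)) * of_nat (Poly_Mapping.lookup m v) *
       mon_eval \<rho> (m - Poly_Mapping.single v 1))"
  by (simp add: qpoly_deriv_def qpoly_eval_sum qpoly_eval_single const_ratfun_mult
      const_ratfun_of_nat fps_of_nat flip: fps_const_mult)

lemma qpoly_taylor:
  assumes "finite V" "qpoly_vars F \<subseteq> V" and "\<And>v. v \<in> V \<Longrightarrow> d dvd \<sigma> v"
  shows "d\<^sup>2 dvd qpoly_eval (\<lambda>v. \<rho> v + \<sigma> v) F - qpoly_eval \<rho> F -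
           (\<Sum>v\<in>V. \<sigma> v * qpoly_eval \<rho> (qpoly_deriv v F))"
proof -
  define T where "T m = mon_eval (\<lambda>v. \<rho> v + \<sigma> v) m - mon_eval \<rho> m -
    (\<Sum>v\<in>V. \<sigma> v * of_nat (Poly_Mapping.lookup m v) * mon_eval \<rho> (m - Poly_Mapping.single v 1))" for m
  have "d\<^sup>2 dvd T m" if "m \<in> Poly_Mapping.keys F" for m
  proof -
    have keys: "Poly_Mapping.keys m \<subseteq> V"
      using that assms(2) by (auto simp: qpoly_vars_def)
    then have "Poly_Mapping.keys (m - Poly_Mapping.single v 1) \<subseteq> V" for v
      by (auto simp: in_keys_iff lookup_minus)
    moreover have "Poly_Mapping.lookup (m - Poly_Mapping.single v 1) u =
        Poly_Mapping.lookup m u - (if u = v then 1 else 0)" for u v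
      by (simp add: lookup_minus lookup_single when_def)
    ultimately show ?thesis
      using prod_power_add_taylor[of V d \<sigma> \<rho> "Poly_Mapping.lookup m"] assms(1,3) keys
      by (simp add: T_def mon_eval_superset[of V])
  qed
  then have "d\<^sup>2 dvd (\<Sum>m\<in>Poly_Mapping.keys F. fps_const (const_ratfun (Poly_Mapping.lookup F m)) * T m)"
    by (intro dvd_sum) auto
  also have "(\<Sum>m\<in>Poly_Mapping.keys F. fps_const (const_ratfun (Poly_Mapping.lookup F m)) * T m) =
      qpoly_eval (\<lambda>v. \<rho> v + \<sigma> v) F - qpoly_eval \<rho> F -
      (\<Sum>v\<in>V. \<sigma> v * qpoly_eval \<rho> (qpoly_deriv v F))"
    unfolding T_def qpoly_eval_deriv sum_distrib_left right_diff_distrib sum_subtractf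
      qpoly_eval_superset[OF finite_keys order_refl, of _ F]
    by (subst (2) sum.swap) (simp add: mult_ac)
  finally show ?thesis .
qed

text \<open>Lowering the exponent of \<open>v\<close> is injective on monomials containing
  \<open>v\<close>, so no terms merge. In characteristic 0 a vanishing derivative thus excludes
  \<open>v\<close> from the polynomial.\<close>

lemma lookup_qpoly_deriv:
  "Poly_Mapping.lookup (qpoly_deriv v F) (m - Poly_Mapping.single v 1) =
     Poly_Mapping.lookup F m * of_nat (Poly_Mapping.lookup m v)"
  if "Poly_Mapping.lookup m v > 0"
proof -
  have "m' = m" if "m' - Poly_Mapping.single v 1 = m - Poly_Mapping.single v 1"
    "Poly_Mapping.lookup m' v > 0" for m'
  proof (rule poly_mapping_eqI)
    fix u
    show "Poly_Mapping.lookup m' u = Poly_Mapping.lookup m u"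
      using arg_cong[OF that(1), of "\<lambda>m. Poly_Mapping.lookup m u"] that(2)
        \<open>Poly_Mapping.lookup m v > 0\<close>
      by (cases "u = v") (simp_all add: lookup_minus lookup_single when_def)
  qed
  then have "Poly_Mapping.lookup (qpoly_deriv v F) (m - Poly_Mapping.single v 1) =
      (\<Sum>m'\<in>Poly_Mapping.keys F. if m' = m then Poly_Mapping.lookup F m * of_nat (Poly_Mapping.lookup m v) else 0)"
    unfolding qpoly_deriv_def lookup_sum
    by (intro sum.cong) (auto simp: lookup_single when_def)
  then show ?thesis
    by (simp add: in_keys_iff)
qed

lemma keys_qpoly_deriv:
  assumes "m \<in> Poly_Mapping.keys (qpoly_deriv v F)"
  obtains m' where "m' \<in> Poly_Mapping.keys F" "Poly_Mapping.lookup m' v > 0"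
    "m = m' - Poly_Mapping.single v 1"
proof -
  have "Poly_Mapping.lookup (qpoly_deriv v F) m \<noteq> 0"
    using assms by (simp add: in_keys_iff)
  then obtain m' where "m' \<in> Poly_Mapping.keys F" and
    "Poly_Mapping.lookup (Poly_Mapping.single (m' - Poly_Mapping.single v 1)
       (Poly_Mapping.lookup F m' * of_nat (Poly_Mapping.lookup m' v))) m \<noteq> 0"
    unfolding qpoly_deriv_def lookup_sum by (meson sum.not_neutral_contains_not_neutral)
  then show ?thesis
    using that by (auto simp: lookup_single when_def split: if_splits)
qed

lemma qpoly_vars_deriv: "qpoly_vars (qpoly_deriv v F) \<subseteq> qpoly_vars F"
proof
  fix u assume "u \<in> qpoly_vars (qpoly_deriv v F)"
  then obtain m where "m \<in> Poly_Mapping.keys (qpoly_deriv v F)" "u \<in> Poly_Mapping.keys m"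
    by (auto simp: qpoly_vars_def)
  moreover from this(1) obtain m' where "m' \<in> Poly_Mapping.keys F" "m = m' - Poly_Mapping.single v 1"
    by (rule keys_qpoly_deriv)
  ultimately have "u \<in> Poly_Mapping.keys m'"
    by (simp add: in_keys_iff lookup_minus)
  with \<open>m' \<in> Poly_Mapping.keys F\<close> show "u \<in> qpoly_vars F"
    by (auto simp: qpoly_vars_def)
qed

section \<open>Valuations\<close>

text \<open>The negative of an additive valuation, hence the max, so that degree and minus order
  both fit. The value at 0 is left free; \<open>val_le\<close> treats it as minus infinity.\<close>

locale valuation =
  fixes \<nu> :: "'a::field \<Rightarrow> real"
  assumes val_mult: "a \<noteq> 0 \<Longrightarrow> b \<noteq> 0 \<Longrightarrow> \<nu> (a * b) = \<nu> a + \<nu> b"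
    and val_add: "a \<noteq> 0 \<Longrightarrow> b \<noteq> 0 \<Longrightarrow> a + b \<noteq> 0 \<Longrightarrow> \<nu> (a + b) \<le> max (\<nu> a) (\<nu> b)"
begin

definition val_le :: "'a \<Rightarrow> real \<Rightarrow> bool" where
  "val_le a t \<longleftrightarrow> a = 0 \<or> \<nu> a \<le> t"

lemma val_1: "\<nu> 1 = 0"
  using val_mult[of 1 1] by simp

lemma val_minus: "\<nu> (- a) = \<nu> a"
proof (cases "a = 0")
  case False
  have "\<nu> (-1) = 0"
    using val_mult[of "-1" "-1"] val_1 by simp
  then show ?thesis
    using val_mult[of "-1" a] False by simp
qed simp

lemma val_power: "a \<noteq> 0 \<Longrightarrow> \<nu> (a ^ k) = k * \<nu> a"
  by (induction k) (simp_all add: val_1 val_mult algebra_simps)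

lemma val_inverse: "a \<noteq> 0 \<Longrightarrow> \<nu> (inverse a) = - \<nu> a"
  using val_mult[of a "inverse a"] by (simp add: val_1)

text \<open>Write b as (a + b) - a: since the value of a is too small, the ultrametric inequality
  forces a + b to have at least the value of b.\<close>

lemma val_add_dominant:
  assumes "b \<noteq> 0" "a = 0 \<or> \<nu> a < \<nu> b"
  shows "a + b \<noteq> 0 \<and> \<nu> (a + b) = \<nu> b"
proof (cases "a = 0")
  case False
  then have less: "\<nu> a < \<nu> b"
    using assms by simp
  then have ne: "a + b \<noteq> 0"
    using val_minus[of a] by (metis add_eq_0_iff less_irrefl)
  have "\<nu> (a + b + - a) \<le> max (\<nu> (a + b)) (\<nu> (- a))"
    using ne False assms by (intro val_add) auto
  then have "\<nu> b \<le> max (\<nu> (a + b)) (\<nu> a)"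
    by (simp add: val_minus)
  then show ?thesis
    using ne less val_add[OF False assms(1) ne] by auto
qed (use assms in simp)

lemma val_le_0: "val_le 0 t"
  and val_le_1: "val_le 1 0"
  by (simp_all add: val_le_def val_1)

lemma val_le_mono: "val_le a s \<Longrightarrow> s \<le> t \<Longrightarrow> val_le a t"
  by (auto simp: val_le_def)

lemma val_le_add:
  assumes "val_le a t" "val_le b t"
  shows "val_le (a + b) t"
  using assms val_add[of a b] by (cases "a = 0"; cases "b = 0"; cases "a + b = 0") (auto simp: val_le_def)

lemma val_le_sum: "(\<And>i. i \<in> I \<Longrightarrow> val_le (f i) t) \<Longrightarrow> val_le (\<Sum>i\<in>I. f i) t"
  by (induction I rule: infinite_finite_induct) (auto simp: val_le_0 val_le_add)

lemma val_le_mult: "val_le a s \<Longrightarrow> val_le b t \<Longrightarrow> val_le (a * b) (s + t)"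
  by (cases "a = 0"; cases "b = 0") (auto simp: val_le_def val_mult)

lemma val_le_minus_iff: "val_le (- a) t \<longleftrightarrow> val_le a t"
  by (simp add: val_le_def val_minus)

text \<open>Horner induction: in a + g^h p(g^h) the second summand has value tending to infinity, so
  it eventually dominates a and the bound for p carries over.\<close>

lemma val_poly_at_powers_pos:
  assumes "\<nu> g > 0" "g \<noteq> 0" "p \<noteq> 0"
  shows "\<exists>c. \<forall>\<^sub>F h in sequentially. poly p (g ^ h) \<noteq> 0 \<and> \<nu> (poly p (g ^ h)) \<ge> c"
  using assms(3)
proof (induction p)
  case (pCons a p)
  show ?case
  proof (cases "p = 0")
    case False
    then obtain c where c:
      "\<forall>\<^sub>F h in sequentially. poly p (g ^ h) \<noteq> 0 \<and> \<nu> (poly p (g ^ h)) \<ge> c"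
      using pCons.IH by blast
    have "filterlim (\<lambda>h. real h * \<nu> g) at_top sequentially"
      using assms(1) by (rule filterlim_at_top_mult_tendsto_pos[OF tendsto_const _ filterlim_real_sequentially])
    then have "\<forall>\<^sub>F h in sequentially. real h * \<nu> g \<ge> \<bar>\<nu> a\<bar> + \<bar>c\<bar> + 1"
      by (simp add: filterlim_at_top)
    with c have "\<forall>\<^sub>F h in sequentially. poly (pCons a p) (g ^ h) \<noteq> 0 \<and> \<nu> (poly (pCons a p) (g ^ h)) \<ge> c"
    proof eventually_elim
      case (elim h)
      have "\<nu> (g ^ h * poly p (g ^ h)) = real h * \<nu> g + \<nu> (poly p (g ^ h))"
        using elim assms by (simp add: val_mult val_power)
      then have "\<nu> (g ^ h * poly p (g ^ h)) > \<nu> a" "\<nu> (g ^ h * poly p (g ^ h)) \<ge> c"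
        using elim by linarith+
      then show ?case
        using val_add_dominant[of "g ^ h * poly p (g ^ h)" a] elim assms by simp
    qed
    then show ?thesis
      by blast
  qed (use pCons.hyps in auto)
qed simp

lemma val_poly_at_powers:
  assumes "\<nu> g \<noteq> 0" "g \<noteq> 0" "p \<noteq> 0"
  shows "\<exists>c\<ge>0. \<forall>\<^sub>F h in sequentially. poly p (g ^ h) \<noteq> 0 \<and> \<nu> (poly p (g ^ h)) \<ge> - c * real h - c"
proof (cases "\<nu> g > 0")
  case True
  then obtain c where c: "\<forall>\<^sub>F h in sequentially. poly p (g ^ h) \<noteq> 0 \<and> \<nu> (poly p (g ^ h)) \<ge> c"
    using val_poly_at_powers_pos assms by blast
  have "c \<ge> - \<bar>c\<bar> * real h - \<bar>c\<bar>" for h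
    using mult_nonneg_nonneg[of "\<bar>c\<bar>" "real h"] by linarith
  with c have "\<forall>\<^sub>F h in sequentially. poly p (g ^ h) \<noteq> 0 \<and> \<nu> (poly p (g ^ h)) \<ge> - \<bar>c\<bar> * real h - \<bar>c\<bar>"
    by (auto elim!: eventually_mono intro: order_trans)
  then show ?thesis
    by (intro exI[of _ "\<bar>c\<bar>"]) simp
next
  case False
  \<comment> \<open>For negative value, pass to the reflected polynomial at 1/g. The factor
    (g^h)^(deg p) costs only a linear term in h.\<close>
  then have "\<nu> (inverse g) > 0" "inverse g \<noteq> 0" "reflect_poly p \<noteq> 0"
    using assms by (simp_all add: val_inverse)
  then obtain c where c: "\<forall>\<^sub>F h in sequentially. poly (reflect_poly p) (inverse g ^ h) \<noteq> 0 \<and>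
      \<nu> (poly (reflect_poly p) (inverse g ^ h)) \<ge> c"
    using val_poly_at_powers_pos by blast
  define c' where "c' = \<bar>c\<bar> + degree p * \<bar>\<nu> g\<bar>"
  have "\<forall>\<^sub>F h in sequentially. poly p (g ^ h) \<noteq> 0 \<and> \<nu> (poly p (g ^ h)) \<ge> - c' * real h - c'"
    using c
  proof eventually_elim
    case (elim h)
    have "poly (reflect_poly p) (inverse g ^ h) = (inverse g ^ h) ^ degree p * poly p (g ^ h)"
      using assms by (simp add: poly_reflect_poly_nz power_inverse)
    then have "poly p (g ^ h) = (g ^ h) ^ degree p * poly (reflect_poly p) (inverse g ^ h)"
      using assms by (simp add: power_inverse field_simps)
    then have ne: "poly p (g ^ h) \<noteq> 0" and
      "\<nu> (poly p (g ^ h)) = degree p * (h * \<nu> g) + \<nu> (poly (reflect_poly p) (inverse g ^ h))"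
      using elim assms by (simp_all add: val_mult val_power)
    moreover have "degree p * (h * \<nu> g) \<ge> - (degree p * \<bar>\<nu> g\<bar>) * h"
      using False by (simp add: abs_if)
    moreover have "- (\<bar>c\<bar> * h) \<le> 0" "- (degree p * \<bar>\<nu> g\<bar>) \<le> 0"
      by simp_all
    ultimately have "\<nu> (poly p (g ^ h)) \<ge> - (degree p * \<bar>\<nu> g\<bar>) * h - \<bar>c\<bar> * h - \<bar>c\<bar> - degree p * \<bar>\<nu> g\<bar>"
      using elim by linarith
    then show ?case
      using ne by (simp add: c'_def algebra_simps)
  qed
  then show ?thesis
    by (intro exI[of _ c']) (simp add: c'_def)
qed

section \<open>Coefficient bounds with a common growth profile\<close>

definition coeffs_le :: "nat \<Rightarrow> (nat \<Rightarrow> real) \<Rightarrow> real \<Rightarrow> 'a fps \<Rightarrow> bool" where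
  "coeffs_le N \<psi> c f \<longleftrightarrow> (\<forall>m\<le>N. val_le (fps_nth f m) (c + \<psi> m))"

lemma coeffs_le_mono: "coeffs_le N \<psi> c f \<Longrightarrow> c \<le> c' \<Longrightarrow> coeffs_le N \<psi> c' f"
  unfolding coeffs_le_def by (meson add_right_mono val_le_mono)

lemma coeffs_le_sum: "(\<And>i. i \<in> I \<Longrightarrow> coeffs_le N \<psi> c (f i)) \<Longrightarrow> coeffs_le N \<psi> c (\<Sum>i\<in>I. f i)"
  unfolding coeffs_le_def by (simp add: fps_sum_nth val_le_sum)

lemma coeffs_le_const:
  assumes "val_le a c" "\<psi> 0 \<ge> 0"
  shows "coeffs_le N \<psi> c (fps_const a)"
  using assms by (auto simp: coeffs_le_def val_le_def)

context
  fixes N :: nat and \<psi> :: "nat \<Rightarrow> real"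
  assumes nonneg: "\<And>m. m \<le> N \<Longrightarrow> \<psi> m \<ge> 0"
    and superadd: "\<And>a b. a + b \<le> N \<Longrightarrow> \<psi> a + \<psi> b \<le> \<psi> (a + b)"
begin

text \<open>Superadditivity lets the profile \<open>\<psi>\<close> survive products while only the
  constants add. It is demanded up to \<open>N\<close> only, since the profile used later is
  superadditive just on a finite range.\<close>

lemma coeffs_le_mult:
  assumes "coeffs_le N \<psi> c f" "coeffs_le N \<psi> d g"
  shows "coeffs_le N \<psi> (c + d) (f * g)"
  unfolding coeffs_le_def fps_mult_nth
proof (intro allI impI val_le_sum)
  fix m i assume "m \<le> N" "i \<in> {0..m}"
  then have "val_le (fps_nth f i * fps_nth g (m - i)) (c + \<psi> i + (d + \<psi> (m - i)))"
    using assms by (intro val_le_mult) (auto simp: coeffs_le_def)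
  then show "val_le (fps_nth f i * fps_nth g (m - i)) (c + d + \<psi> m)"
    using superadd[of i "m - i"] \<open>m \<le> N\<close> \<open>i \<in> {0..m}\<close> by (elim val_le_mono) auto
qed

lemma coeffs_le_1: "coeffs_le N \<psi> 0 1"
  using nonneg[of 0] coeffs_le_const[OF val_le_1] by simp

lemma coeffs_le_power: "coeffs_le N \<psi> c f \<Longrightarrow> coeffs_le N \<psi> (k * c) (f ^ k)"
  by (induction k) (use coeffs_le_1 coeffs_le_mult in \<open>force simp: algebra_simps\<close>)+

lemma coeffs_le_prod:
  "(\<And>i. i \<in> I \<Longrightarrow> coeffs_le N \<psi> (c i) (f i)) \<Longrightarrow> coeffs_le N \<psi> (\<Sum>i\<in>I. c i) (\<Prod>i\<in>I. f i)"
  by (induction I rule: infinite_finite_induct) (auto simp: coeffs_le_1 coeffs_le_mult)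

end

end

section \<open>Nondegenerate equations and the recurrence\<close>

lemma Fract_sum: "Fraction_Field.Fract (\<Sum>i\<in>I. f i) 1 = (\<Sum>i\<in>I. Fraction_Field.Fract (f i) (1::'a::idom))"
proof -
  have "Fraction_Field.Fract (a + b) 1 = Fraction_Field.Fract a 1 + Fraction_Field.Fract b 1" for a b :: 'a
    by simp
  then show ?thesis
    by (induction I rule: infinite_finite_induct) (simp_all only: Zero_fract_def sum.insert sum.empty sum.infinite not_False_eq_True)
qed

lemma q_var_power: "q_var ^ k = Fraction_Field.Fract (monom 1 k) 1"
  by (induction k) (simp_all add: q_var_def One_fract_def monom_Suc mult_fract)

lemma const_ratfun_q_var_power: "const_ratfun c * q_var ^ k = Fraction_Field.Fract (monom c k) 1"
  by (simp add: q_var_power const_ratfun_def smult_monom)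

text \<open>Algebraic independence of q and x over the constants.\<close>

lemma qpoly_eval_QX_eq_0D:
  assumes vars: "qpoly_vars F \<subseteq> {Q, X}" and zero: "qpoly_eval (q_assign y) F = 0"
  shows "F = 0"
proof (rule ccontr)
  assume "F \<noteq> 0"
  then obtain m where m: "m \<in> Poly_Mapping.keys F"
    by (metis all_not_in_conv keys_eq_empty)
  define a b where "a = Poly_Mapping.lookup m Q" and "b = Poly_Mapping.lookup m X"
  have keys: "Poly_Mapping.keys m' \<subseteq> {Q, X}" if "m' \<in> Poly_Mapping.keys F" for m'
    using that vars by (auto simp: qpoly_vars_def)
  \<comment> \<open>The coefficient of x^b in the value of \<open>F\<close>, as a polynomial in q;
    its coefficient at q^a is that of the chosen monomial \<open>m\<close>, the only one with
    exponents (a, b).\<close>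
  define p where "p = (\<Sum>m\<in>Poly_Mapping.keys F. if Poly_Mapping.lookup m X = b
      then monom (Poly_Mapping.lookup F m) (Poly_Mapping.lookup m Q) else 0)"
  have "fps_nth (qpoly_eval (q_assign y) F) b = Fraction_Field.Fract p 1"
    unfolding qpoly_eval_superset[OF finite_keys order_refl] fps_sum_nth p_def Fract_sum
  proof (rule sum.cong)
    fix m' assume "m' \<in> Poly_Mapping.keys F"
    then have "mon_eval (q_assign y) m' =
        fps_const (q_var ^ Poly_Mapping.lookup m' Q) * fps_X ^ Poly_Mapping.lookup m' X"
      using keys by (simp add: mon_eval_superset[of "{Q, X}"] fps_const_power)
    then have "fps_const (const_ratfun (Poly_Mapping.lookup F m')) * mon_eval (q_assign y) m' =
        fps_const (const_ratfun (Poly_Mapping.lookup F m') * q_var ^ Poly_Mapping.lookup m' Q) *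
          fps_X ^ Poly_Mapping.lookup m' X"
      by (simp add: mult.assoc flip: fps_const_mult)
    then show "fps_nth (fps_const (const_ratfun (Poly_Mapping.lookup F m')) * mon_eval (q_assign y) m') b =
        Fraction_Field.Fract (if Poly_Mapping.lookup m' X = b
          then monom (Poly_Mapping.lookup F m') (Poly_Mapping.lookup m' Q) else 0) 1"
      by (auto simp: const_ratfun_q_var_power Zero_fract_def)
  qed simp
  then have "Fraction_Field.Fract p 1 = 0"
    using zero by simp
  then have "p = 0"
    using Fract_nonzero[of p 1] by auto
  moreover have "coeff p a = (\<Sum>m'\<in>Poly_Mapping.keys F. if m' = m then Poly_Mapping.lookup F m else 0)"
    unfolding p_def coeff_sum
  proof (rule sum.cong)
    fix m' assume "m' \<in> Poly_Mapping.keys F"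
    then have "Poly_Mapping.lookup m' u = Poly_Mapping.lookup m u"
      if "Poly_Mapping.lookup m' X = b" "Poly_Mapping.lookup m' Q = a" for u
    proof (cases "u \<in> {Q, X}")
      case False
      then have "u \<notin> Poly_Mapping.keys m'" "u \<notin> Poly_Mapping.keys m"
        using keys[OF \<open>m' \<in> _\<close>] keys[OF m] by auto
      then show ?thesis
        by (simp add: in_keys_iff)
    qed (use that in \<open>auto simp: a_def b_def\<close>)
    then have "m' = m \<longleftrightarrow> Poly_Mapping.lookup m' X = b \<and> Poly_Mapping.lookup m' Q = a"
      by (auto intro: poly_mapping_eqI simp: a_def b_def)
    then show "coeff (if Poly_Mapping.lookup m' X = b
          then monom (Poly_Mapping.lookup F m') (Poly_Mapping.lookup m' Q) else 0) a =
        (if m' = m then Poly_Mapping.lookup F m else 0)"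
      by auto
  qed simp
  ultimately show False
    using m by (simp add: in_keys_iff)
qed

text \<open>In characteristic 0 a nonzero equation of minimal degree in the \<open>W i\<close> is separable
  along the solution: its partial derivatives cannot all vanish there.\<close>

lemma exists_nondegenerate_equation:
  assumes "F \<noteq> 0" "qpoly_vars F \<subseteq> {Q, X} \<union> W ` {..n}" "qpoly_eval (q_assign y) F = 0"
  shows "\<exists>G. qpoly_vars G \<subseteq> {Q, X} \<union> W ` {..n} \<and> qpoly_eval (q_assign y) G = 0 \<and>
    (\<exists>i\<le>n. qpoly_eval (q_assign y) (qpoly_deriv (W i) G) \<noteq> 0)"
proof -
  define wdeg where "wdeg m = (\<Sum>i\<le>n. Poly_Mapping.lookup m (W i))" for m :: "qvar \<Rightarrow>\<^sub>0 nat"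
  have "\<forall>m\<in>Poly_Mapping.keys F. wdeg m \<le> (\<Sum>m\<in>Poly_Mapping.keys F. wdeg m)"
    by (auto intro: member_le_sum)
  then obtain N where "\<forall>m\<in>Poly_Mapping.keys F. wdeg m \<le> N"
    by blast
  then show ?thesis
    using assms
  proof (induction N arbitrary: F rule: less_induct)
    case (less N)
    show ?case
    proof (rule ccontr)
      assume contra: "\<not> ?case"
      have deriv: "qpoly_deriv (W i) F = 0" if "i \<le> n" for i
      proof (rule ccontr)
        assume nonzero: "qpoly_deriv (W i) F \<noteq> 0"
        have smaller: "wdeg m < N" if m: "m \<in> Poly_Mapping.keys (qpoly_deriv (W i) F)" for m
        proof -
          obtain m' where m': "m' \<in> Poly_Mapping.keys F" "Poly_Mapping.lookup m' (W i) > 0"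
            "m = m' - Poly_Mapping.single (W i) 1"
            using m by (rule keys_qpoly_deriv)
          have "wdeg m < wdeg m'"
            unfolding wdeg_def using m' \<open>i \<le> n\<close>
            by (intro sum_strict_mono_ex1) (auto simp: lookup_minus intro!: bexI[of _ i])
          then show ?thesis
            using less.prems(1) m'(1) by fastforce
        qed
        \<comment> \<open>A monomial of degree below \<open>N\<close> exists, so \<open>N\<close> is
          positive and \<open>N - 1\<close> really decreases.\<close>
        moreover obtain m where "m \<in> Poly_Mapping.keys (qpoly_deriv (W i) F)"
          using nonzero by (metis all_not_in_conv keys_eq_empty)
        ultimately have "N - 1 < N" "\<forall>m\<in>Poly_Mapping.keys (qpoly_deriv (W i) F). wdeg m \<le> N - 1"
          by fastforce+
        moreover have "qpoly_vars (qpoly_deriv (W i) F) \<subseteq> {Q, X} \<union> W ` {..n}"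
          using qpoly_vars_deriv less.prems(3) by blast
        moreover have "qpoly_eval (q_assign y) (qpoly_deriv (W i) F) = 0"
          using contra less.prems that by blast
        ultimately show False
          using less.IH nonzero contra by blast
      qed
      \<comment> \<open>All derivatives in the \<open>W i\<close> vanish identically, so
        \<open>F\<close> involves only q and x, which are independent.\<close>
      have "W i \<notin> qpoly_vars F" if "i \<le> n" for i
        using lookup_qpoly_deriv[of _ "W i" F] deriv[OF that]
        by (fastforce simp: qpoly_vars_def in_keys_iff)
      then have "qpoly_vars F \<subseteq> {Q, X}"
        using less.prems(3) by auto
      then show False
        using qpoly_eval_QX_eq_0D less.prems by blast
    qed
  qed
qed

section \<open>The recurrence for the coefficients of a solution\<close>

lemma fps_X_power_dvd_iff: "fps_X ^ h dvd f \<longleftrightarrow> (\<forall>m<h. fps_nth f m = 0)"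
  for f :: "'a::comm_ring_1 fps"
proof
  assume "\<forall>m<h. fps_nth f m = 0"
  then have "fps_cutoff h f = 0"
    by (simp add: fps_eq_iff)
  then have "f = fps_X ^ h * fps_shift h f"
    by (metis add.right_neutral fps_shift_cutoff')
  then show "fps_X ^ h dvd f"
    by (rule dvdI)
qed (auto simp: fps_X_power_mult_nth elim!: dvdE)

text \<open>Expand at \<open>y\<close> with the increment \<open>\<sigma>\<close> from
  \<open>y\<close> to its truncation, which x^h divides. The quadratic error starts at degree 2h > h
  + v, so only the linear term counts.\<close>

lemma qpoly_eval_cutoff_nth:
  fixes n h v :: nat and y :: "ratfun fps" and F :: qpoly
  defines "A \<equiv> \<lambda>i. qpoly_eval (q_assign y) (qpoly_deriv (W i) F)"
  assumes vars: "qpoly_vars F \<subseteq> {Q, X} \<union> W ` {..n}" and zero: "qpoly_eval (q_assign y) F = 0"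
    and vanish: "\<And>i j. i \<le> n \<Longrightarrow> j < v \<Longrightarrow> fps_nth (A i) j = 0" and "v < h"
  shows "fps_nth (qpoly_eval (q_assign (fps_cutoff h y)) F) (h + v) =
    - (fps_nth y h * (\<Sum>i\<le>n. fps_nth (A i) v * (q_var ^ h) ^ i))"
proof -
  define V where "V = {Q, X} \<union> W ` {..n}"
  define \<sigma> where "\<sigma> u = q_assign (fps_cutoff h y) u - q_assign y u" for u
  have \<sigma>_low: "fps_nth (\<sigma> u) m = 0" if "m < h" for u m
    using that by (cases u) (simp_all add: \<sigma>_def q_shift_def)
  have \<sigma>_h: "fps_nth (\<sigma> (W i)) h = - (q_var ^ (i * h) * fps_nth y h)" for i
    by (simp add: \<sigma>_def q_shift_def)
  have "(fps_X ^ h)\<^sup>2 dvd qpoly_eval (\<lambda>u. q_assign y u + \<sigma> u) F - qpoly_eval (q_assign y) F -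
      (\<Sum>u\<in>V. \<sigma> u * qpoly_eval (q_assign y) (qpoly_deriv u F))"
    using vars \<sigma>_low by (intro qpoly_taylor) (auto simp: V_def fps_X_power_dvd_iff)
  then have "fps_X ^ (2 * h) dvd qpoly_eval (q_assign (fps_cutoff h y)) F -
      (\<Sum>u\<in>V. \<sigma> u * qpoly_eval (q_assign y) (qpoly_deriv u F))"
    by (simp add: \<sigma>_def zero mult.commute flip: power_mult)
  then have "fps_nth (qpoly_eval (q_assign (fps_cutoff h y)) F) (h + v) =
      (\<Sum>u\<in>V. fps_nth (\<sigma> u * qpoly_eval (q_assign y) (qpoly_deriv u F)) (h + v))"
    using \<open>v < h\<close> by (simp add: fps_X_power_dvd_iff fps_sum_nth)
  also have "\<dots> = (\<Sum>u\<in>W ` {..n}. fps_nth (\<sigma> u * qpoly_eval (q_assign y) (qpoly_deriv u F)) (h + v))"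
    by (rule sum.mono_neutral_right) (auto simp: V_def \<sigma>_def)
  also have "\<dots> = (\<Sum>i\<le>n. fps_nth (\<sigma> (W i) * A i) (h + v))"
    by (subst sum.reindex) (auto simp: A_def inj_on_def)
  also have "\<dots> = (\<Sum>i\<le>n. - (fps_nth y h * (fps_nth (A i) v * (q_var ^ h) ^ i)))"
  proof (rule sum.cong)
    fix i assume "i \<in> {..n}"
    \<comment> \<open>For j < h the increment vanishes; for j > h the index h + v - j lies below
      \<open>v\<close>, where \<open>A i\<close> vanishes.\<close>
    have "fps_nth (\<sigma> (W i)) j * fps_nth (A i) (h + v - j) = 0" if "j \<noteq> h" "j \<le> h + v" for j
      using that \<sigma>_low[of j] vanish[of i "h + v - j"] \<open>i \<in> {..n}\<close> by (cases "j < h") auto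
    then have "fps_nth (\<sigma> (W i) * A i) (h + v) = (\<Sum>j\<in>{h}. fps_nth (\<sigma> (W i)) j * fps_nth (A i) (h + v - j))"
      unfolding fps_mult_nth by (intro sum.mono_neutral_right) auto
    then show "fps_nth (\<sigma> (W i) * A i) (h + v) = - (fps_nth y h * (fps_nth (A i) v * (q_var ^ h) ^ i))"
      by (simp add: \<sigma>_h mult_ac flip: power_mult)
  qed simp
  finally show ?thesis
    by (simp add: sum_distrib_left sum_negf)
qed

section \<open>Quadratic growth of solutions\<close>

text \<open>The largest value of a sum of squares of naturals below \<open>h\<close> with total \<open>m\<close>, for \<open>m \<le> 2 * h - 2\<close>.\<close>

definition quad :: "nat \<Rightarrow> nat \<Rightarrow> real" where
  "quad h m = (if m < h then (real m)\<^sup>2 else (real h - 1)\<^sup>2 + (real m - real h + 1)\<^sup>2)"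

lemma quad_nonneg: "quad h m \<ge> 0"
  by (simp add: quad_def)

text \<open>The gap is 2ab if a + b < h, 2(h-1-a)(h-1-b) if a, b < h <= a + b, and 2(a-h+1)b if b <
  h <= a. The hypothesis excludes a, b >= h.\<close>

lemma quad_superadd:
  assumes "a + b < 2 * h"
  shows "quad h a + quad h b \<le> quad h (a + b)"
proof -
  have mixed: "quad h a + quad h b \<le> quad h (a + b)" if "a \<ge> h" "b < h" for a b
  proof -
    have "0 \<le> 2 * (real a - real h + 1) * real b"
      using that by simp
    then show ?thesis
      using that by (simp add: quad_def power2_eq_square algebra_simps)
  qed
  show ?thesis
  proof (cases "a < h \<and> b < h")
    case True
    then have "0 \<le> 2 * (real h - 1 - real a) * (real h - 1 - real b)"
      by simp
    moreover have "0 \<le> 2 * (real a * real b)"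
      by simp
    ultimately show ?thesis
      using True by (auto simp: quad_def power2_eq_square algebra_simps)
  next
    case False
    then show ?thesis
      using mixed[of a b] mixed[of b a] assms by (cases "a < h") (auto simp: add.commute)
  qed
qed

locale ratfun_valuation = valuation \<nu> for \<nu> :: "ratfun \<Rightarrow> real" +
  assumes val_q_var: "\<nu> q_var \<noteq> 0"
    and val_const: "c \<noteq> 0 \<Longrightarrow> \<nu> (const_ratfun c) = 0"
begin

text \<open>Constants have value 0, so a monomial costs \<open>e\<close> for each of its at most
  \<open>D\<close> factors.\<close>

lemma coeffs_le_qpoly_eval:
  assumes \<psi>: "\<And>m. m \<le> N \<Longrightarrow> \<psi> m \<ge> 0" "\<And>a b. a + b \<le> N \<Longrightarrow> \<psi> a + \<psi> b \<le> \<psi> (a + b)"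
    and vars: "qpoly_vars F \<subseteq> V" "\<And>u. u \<in> V \<Longrightarrow> coeffs_le N \<psi> e (\<rho> u)" and "e \<ge> 0"
    and deg: "\<And>m. m \<in> Poly_Mapping.keys F \<Longrightarrow> (\<Sum>u\<in>Poly_Mapping.keys m. Poly_Mapping.lookup m u) \<le> D"
  shows "coeffs_le N \<psi> (real D * e) (qpoly_eval \<rho> F)"
  unfolding qpoly_eval_superset[OF finite_keys order_refl]
proof (rule coeffs_le_sum)
  fix m assume m: "m \<in> Poly_Mapping.keys F"
  have "val_le (const_ratfun (Poly_Mapping.lookup F m)) 0"
    using val_const[of "Poly_Mapping.lookup F m"] m by (simp add: val_le_def in_keys_iff)
  then have const: "coeffs_le N \<psi> 0 (fps_const (const_ratfun (Poly_Mapping.lookup F m)))"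
    using \<psi>(1)[of 0] by (simp add: coeffs_le_const)
  have "coeffs_le N \<psi> (\<Sum>u\<in>Poly_Mapping.keys m. real (Poly_Mapping.lookup m u) * e) (mon_eval \<rho> m)"
    unfolding mon_eval_def
  proof (rule coeffs_le_prod[OF \<psi>])
    fix u assume "u \<in> Poly_Mapping.keys m"
    then have "u \<in> V"
      using m vars(1) by (auto simp: qpoly_vars_def)
    then show "coeffs_le N \<psi> (real (Poly_Mapping.lookup m u) * e) (\<rho> u ^ Poly_Mapping.lookup m u)"
      by (intro coeffs_le_power[OF \<psi>] vars(2))
  qed
  from coeffs_le_mult[OF \<psi> const this]
  show "coeffs_le N \<psi> (real D * e) (fps_const (const_ratfun (Poly_Mapping.lookup F m)) * mon_eval \<rho> m)"
  proof (rule coeffs_le_mono)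
    have "(\<Sum>u\<in>Poly_Mapping.keys m. real (Poly_Mapping.lookup m u)) \<le> real D"
      using deg[OF m] by (simp flip: of_nat_sum)
    then show "0 + (\<Sum>u\<in>Poly_Mapping.keys m. real (Poly_Mapping.lookup m u) * e) \<le> real D * e"
      using \<open>e \<ge> 0\<close> by (simp add: mult_right_mono flip: sum_distrib_right)
  qed
qed

lemma q_var_nonzero: "q_var \<noteq> 0"
  by (simp add: q_var_def Fract_nonzero)

theorem val_solution_quadratic:
  fixes y :: "ratfun fps"
  assumes F: "F \<noteq> 0" "qpoly_vars F \<subseteq> {Q, X} \<union> W ` {..n}" "qpoly_eval (q_assign y) F = 0"
  obtains C where "C \<ge> 0" "\<And>h. h \<ge> 1 \<Longrightarrow> val_le (fps_nth y h) (C * (real h)\<^sup>2)"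
proof -
  obtain G i0 where G: "qpoly_vars G \<subseteq> {Q, X} \<union> W ` {..n}" "qpoly_eval (q_assign y) G = 0"
    and i0: "i0 \<le> n" "qpoly_eval (q_assign y) (qpoly_deriv (W i0) G) \<noteq> 0"
    using exists_nondegenerate_equation[OF F] by blast
  define A where "A i = qpoly_eval (q_assign y) (qpoly_deriv (W i) G)" for i
  define v where "v = (LEAST v. \<exists>i\<le>n. fps_nth (A i) v \<noteq> 0)"
  have "\<exists>v. \<exists>i\<le>n. fps_nth (A i) v \<noteq> 0"
    using i0 unfolding A_def by (metis fps_nonzero_nth)
  then have "\<exists>i\<le>n. fps_nth (A i) v \<noteq> 0"
    unfolding v_def by (rule LeastI_ex)
  then obtain i1 where i1: "i1 \<le> n" "fps_nth (A i1) v \<noteq> 0"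
    by blast
  have vanish: "fps_nth (A i) j = 0" if "i \<le> n" "j < v" for i j
    using not_less_Least[of j "\<lambda>v. \<exists>i\<le>n. fps_nth (A i) v \<noteq> 0"] that unfolding v_def by blast
  define P where "P = (\<Sum>i\<le>n. monom (fps_nth (A i) v) i)"
  have "coeff P i1 = fps_nth (A i1) v"
    using i1 by (simp add: P_def coeff_sum)
  then have "P \<noteq> 0"
    using i1 by auto
  then obtain c where c: "c \<ge> 0"
    "\<forall>\<^sub>F h in sequentially. poly P (q_var ^ h) \<noteq> 0 \<and> \<nu> (poly P (q_var ^ h)) \<ge> - c * real h - c"
    using val_poly_at_powers[OF val_q_var q_var_nonzero] by blast
  then obtain h0 where
    h0: "\<And>h. h \<ge> h0 \<Longrightarrow> poly P (q_var ^ h) \<noteq> 0 \<and> \<nu> (poly P (q_var ^ h)) \<ge> - c * real h - c"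
    unfolding eventually_sequentially by blast
  have step: "fps_nth (qpoly_eval (q_assign (fps_cutoff h y)) G) (h + v) = - (fps_nth y h * poly P (q_var ^ h))"
    if "h > v" for h
    using qpoly_eval_cutoff_nth[OF G vanish[unfolded A_def] that]
    by (simp add: P_def poly_sum poly_monom A_def)

  define tdeg where "tdeg m = (\<Sum>u\<in>Poly_Mapping.keys m. Poly_Mapping.lookup m u)" for m :: "qvar \<Rightarrow>\<^sub>0 nat"
  define D where "D = (\<Sum>m\<in>Poly_Mapping.keys G. tdeg m)"
  have D: "tdeg m \<le> D" if "m \<in> Poly_Mapping.keys G" for m
    unfolding D_def using that by (intro member_le_sum) auto
  define \<kappa> where "\<kappa> = \<bar>\<nu> q_var\<bar>"
  \<comment> \<open>Bounds the values of q and of the coefficient \<open>y\<^sub>0\<close>.\<close>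
  define E where "E = max \<kappa> \<bar>\<nu> (fps_nth y 0)\<bar>"
  \<comment> \<open>Collects the costs of one step: shifts by q^(im) with i <= n and m <= h + v,
    division by P(q^h), and evaluation of \<open>G\<close>. Their total is at most K h.\<close>
  define K where "K = n * \<kappa> * (1 + v) + 2 * c + D * E"
  \<comment> \<open>Ensures h > v, P(q^h) nonzero, and 2h - 1 - (v + 1)^2 >= h.\<close>
  define h1 where "h1 = max h0 ((v + 1)\<^sup>2 + 1)"
  \<comment> \<open>The sum settles the finitely many indices below \<open>h1\<close>;
    \<open>C \<ge> K\<close> drives the induction beyond.\<close>
  define C where "C = K + (\<Sum>j<h1. \<bar>\<nu> (fps_nth y j)\<bar>)"
  have "\<kappa> \<ge> 0" "E \<ge> \<kappa>"
    by (simp_all add: \<kappa>_def E_def)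
  then have "E \<ge> 0" "K \<ge> 0"
    using c(1) by (simp_all add: K_def)
  then have "C \<ge> 0" "C \<ge> K"
    by (simp_all add: C_def sum_nonneg)

  \<comment> \<open>The constant \<open>E\<close> is there for h = 0, where the quadratic term
    vanishes.\<close>
  have bound: "val_le (fps_nth y h) (E + C * (real h)\<^sup>2)" for h
  proof (induction h rule: less_induct)
    case (less h)
    consider "h = 0" | "1 \<le> h" "h < h1" | "h1 \<le> h"
      by linarith
    then show ?case
    proof cases
      case 1
      then show ?thesis
        unfolding val_le_def E_def by auto
    next
      case 2
      have "\<bar>\<nu> (fps_nth y h)\<bar> \<le> (\<Sum>j<h1. \<bar>\<nu> (fps_nth y j)\<bar>)"
        using 2 by (intro member_le_sum) auto
      then have "\<nu> (fps_nth y h) \<le> C * 1"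
        using \<open>K \<ge> 0\<close> by (simp add: C_def)
      also have "\<dots> \<le> C * (real h)\<^sup>2"
        using 2 \<open>C \<ge> 0\<close> by (intro mult_left_mono) auto
      finally show ?thesis
        using \<open>E \<ge> 0\<close> by (simp add: val_le_def)
    next
      case 3
      then have "h \<ge> h0" "h \<ge> (v + 1)\<^sup>2 + 1"
        by (auto simp: h1_def)
      have "v + 1 \<le> (v + 1)\<^sup>2"
        by (simp add: power2_eq_square)
      then have "v < h"
        using \<open>h \<ge> (v + 1)\<^sup>2 + 1\<close> by linarith
      \<comment> \<open>The linear part pays for the q-shifts, the quadratic part for the induction
        hypothesis; h + v < 2h keeps \<open>quad\<close> superadditive.\<close>
      define \<psi> where "\<psi> m = n * \<kappa> * real m + C * quad h m" for m
      have \<psi>_nonneg: "\<psi> m \<ge> 0" for m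
        using \<open>\<kappa> \<ge> 0\<close> \<open>C \<ge> 0\<close> quad_nonneg by (simp add: \<psi>_def)
      have \<psi>_superadd: "\<psi> a + \<psi> b \<le> \<psi> (a + b)" if "a + b \<le> h + v" for a b
        using mult_left_mono[OF quad_superadd[of a b h] \<open>C \<ge> 0\<close>] that \<open>v < h\<close>
        by (simp add: \<psi>_def algebra_simps)
      have "coeffs_le (h + v) \<psi> (real D * E) (qpoly_eval (q_assign (fps_cutoff h y)) G)"
      proof (rule coeffs_le_qpoly_eval[OF \<psi>_nonneg \<psi>_superadd G(1) _ \<open>E \<ge> 0\<close> D[unfolded tdeg_def]])
        fix u assume "u \<in> {Q, X} \<union> W ` {..n}"
        then consider "u = Q" | "u = X" | i where "u = W i" "i \<le> n"
          by auto
        then show "coeffs_le (h + v) \<psi> E (q_assign (fps_cutoff h y) u)"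
        proof cases
          case 1
          have "val_le q_var E"
            using \<open>E \<ge> \<kappa>\<close> unfolding val_le_def \<kappa>_def by linarith
          then show ?thesis
            using 1 \<psi>_nonneg by (simp add: coeffs_le_const)
        next
          case 2
          have "E + \<psi> m \<ge> 0" for m
            using \<open>E \<ge> 0\<close> \<psi>_nonneg[of m] by simp
          then show ?thesis
            using 2 by (auto simp: coeffs_le_def fps_X_def val_le_0 intro: val_le_mono[OF val_le_1])
        next
          case 3
          show ?thesis
            unfolding coeffs_le_def
          proof (intro allI impI)
            fix m
            have "val_le (q_var ^ (i * m) * fps_nth y m) (E + \<psi> m)" if "m < h"
            proof -
              have "\<nu> (q_var ^ (i * m)) = real (i * m) * \<nu> q_var"
                by (simp add: val_power q_var_nonzero)
              also have "\<dots> \<le> real (i * m) * \<kappa>"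
                by (intro mult_left_mono) (auto simp: \<kappa>_def)
              also have "\<dots> \<le> real (n * m) * \<kappa>"
                using 3 \<open>\<kappa> \<ge> 0\<close> by (intro mult_right_mono) (auto simp: mult_right_mono)
              finally have "val_le (q_var ^ (i * m)) (n * \<kappa> * m)"
                by (simp add: val_le_def mult_ac)
              from val_le_mult[OF this less.IH[OF that]] show ?thesis
                using that by (simp add: \<psi>_def quad_def add_ac)
            qed
            then show "val_le (fps_nth (q_assign (fps_cutoff h y) u) m) (E + \<psi> m)"
              using 3 by (simp add: q_shift_def val_le_0)
          qed
        qed
      qed
      then have "val_le (- (fps_nth y h * poly P (q_var ^ h))) (real D * E + \<psi> (h + v))"
        unfolding coeffs_le_def step[OF \<open>v < h\<close>, symmetric] by blast
      then have rhs: "val_le (fps_nth y h * poly P (q_var ^ h)) (real D * E + \<psi> (h + v))"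
        by (simp only: val_le_minus_iff)
      show ?thesis
      proof (cases "fps_nth y h = 0")
        case False
        then have "\<nu> (fps_nth y h) + \<nu> (poly P (q_var ^ h)) \<le> real D * E + \<psi> (h + v)"
          using rhs h0[OF \<open>h \<ge> h0\<close>] by (simp add: val_le_def val_mult)
        then have "\<nu> (fps_nth y h) \<le> c * h + c + D * E + \<psi> (h + v)"
          using h0[OF \<open>h \<ge> h0\<close>] by linarith
        also have "\<psi> (h + v) = n * \<kappa> * h + n * \<kappa> * v + C * ((real h - 1)\<^sup>2 + (real v + 1)\<^sup>2)"
          by (simp add: \<psi>_def quad_def algebra_simps)
        \<comment> \<open>The quadratic part is C h^2 - C (2h - 1 - (v + 1)^2). The subtracted gain
          is at least C h >= K h and absorbs the linear costs.\<close>
        also have "c * h + c + D * E + (n * \<kappa> * h + n * \<kappa> * v + C * ((real h - 1)\<^sup>2 + (real v + 1)\<^sup>2))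
            \<le> C * (real h)\<^sup>2"
        proof -
          have "real h \<ge> 1"
            using \<open>v < h\<close> by simp
          then have "c * 1 \<le> c * h" "D * E * 1 \<le> D * E * h" "n * \<kappa> * v * 1 \<le> n * \<kappa> * v * h"
            using c(1) \<open>E \<ge> 0\<close> \<open>\<kappa> \<ge> 0\<close> by (intro mult_left_mono; simp)+
          then have "c * h + c + D * E + (n * \<kappa> * h + n * \<kappa> * v) \<le> K * h"
            by (simp add: K_def algebra_simps)
          also have "\<dots> \<le> C * h"
            using \<open>C \<ge> K\<close> by (intro mult_right_mono) auto
          also have "real h + (real v + 1)\<^sup>2 + 1 \<le> 2 * real h"
          proof -
            have "real ((v + 1)\<^sup>2 + 1) \<le> real h"
              using \<open>h \<ge> (v + 1)\<^sup>2 + 1\<close> by (rule of_nat_mono)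
            then show ?thesis
              by (simp add: add.commute)
          qed
          then have "C * h \<le> C * (2 * real h - 1 - (real v + 1)\<^sup>2)"
            using \<open>C \<ge> 0\<close> by (intro mult_left_mono) auto
          finally show ?thesis
            by (simp add: power2_eq_square algebra_simps)
        qed
        finally show ?thesis
          using \<open>E \<ge> 0\<close> by (simp add: val_le_def)
      qed (simp add: val_le_0)
    qed
  qed
  show ?thesis
  proof (rule that[of "E + C"])
    show "E + C \<ge> 0"
      using \<open>E \<ge> 0\<close> \<open>C \<ge> 0\<close> by simp
  next
    fix h :: nat assume "h \<ge> 1"
    then have "E * 1 \<le> E * (real h)\<^sup>2"
      using \<open>E \<ge> 0\<close> by (intro mult_left_mono) auto
    then show "val_le (fps_nth y h) ((E + C) * (real h)\<^sup>2)"
      using bound[of h] by (elim val_le_mono) (simp add: algebra_simps)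
  qed
qed

end

section \<open>Degree and order in q\<close>

lemma order_add_ge:
  fixes p q :: "'a::idom poly"
  assumes "p \<noteq> 0" "q \<noteq> 0" "p + q \<noteq> 0"
  shows "min (order a p) (order a q) \<le> order a (p + q)"
proof -
  have "[:-a, 1:] ^ min (order a p) (order a q) dvd p + q"
    using assms by (intro dvd_add) (simp_all add: order_divides)
  then show ?thesis
    using assms by (simp add: order_divides)
qed

lemma ratfun_nonzero_cases:
  fixes r :: ratfun
  assumes "r \<noteq> 0"
  obtains f g where "f \<noteq> 0" "g \<noteq> 0" "r = Fraction_Field.Fract f g"
proof (cases r)
  case (Fract f g)
  then have "f \<noteq> 0"
    using assms by (auto simp: Zero_fract_def eq_fract)
  with Fract show ?thesis
    using that by blast
qed

text \<open>A valuation on polynomials extends to fractions: over the common denominator g g' the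
  ultrametric inequality is that of the numerators.\<close>

lemma ratfun_valuationI:
  fixes w :: "complex poly \<Rightarrow> real"
  assumes Fract: "\<And>f g. f \<noteq> 0 \<Longrightarrow> g \<noteq> 0 \<Longrightarrow> \<nu> (Fraction_Field.Fract f g) = w f - w g"
    and mult: "\<And>f g. f \<noteq> 0 \<Longrightarrow> g \<noteq> 0 \<Longrightarrow> w (f * g) = w f + w g"
    and add: "\<And>f g. f \<noteq> 0 \<Longrightarrow> g \<noteq> 0 \<Longrightarrow> f + g \<noteq> 0 \<Longrightarrow> w (f + g) \<le> max (w f) (w g)"
    and const: "\<And>c. c \<noteq> 0 \<Longrightarrow> w [:c:] = 0" and var: "w [:0, 1:] \<noteq> 0"
  shows "ratfun_valuation \<nu>"
proof
  fix a b :: ratfun assume "a \<noteq> 0" "b \<noteq> 0"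
  obtain f g where fg: "f \<noteq> 0" "g \<noteq> 0" "a = Fraction_Field.Fract f g"
    using \<open>a \<noteq> 0\<close> by (rule ratfun_nonzero_cases)
  obtain f' g' where fg': "f' \<noteq> 0" "g' \<noteq> 0" "b = Fraction_Field.Fract f' g'"
    using \<open>b \<noteq> 0\<close> by (rule ratfun_nonzero_cases)
  show "\<nu> (a * b) = \<nu> a + \<nu> b"
    using fg fg' by (simp add: Fract mult)
  assume "a + b \<noteq> 0"
  moreover have sum: "a + b = Fraction_Field.Fract (f * g' + f' * g) (g * g')"
    using fg fg' by simp
  ultimately have "f * g' + f' * g \<noteq> 0"
    by (auto simp: fract_collapse)
  then have "w (f * g' + f' * g) \<le> max (w (f * g')) (w (f' * g))"
    using fg fg' by (intro add) auto
  moreover have "\<nu> (a + b) = w (f * g' + f' * g) - w (g * g')"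
    unfolding sum using fg fg' \<open>f * g' + f' * g \<noteq> 0\<close> by (intro Fract) auto
  ultimately show "\<nu> (a + b) \<le> max (\<nu> a) (\<nu> b)"
    using fg fg' by (auto simp: Fract mult max_def split: if_splits)
next
  have "w 1 = 0"
    using mult[of 1 1] by simp
  then show "\<nu> q_var \<noteq> 0" "\<And>c. c \<noteq> 0 \<Longrightarrow> \<nu> (const_ratfun c) = 0"
    by (simp_all add: q_var_def const_ratfun_def Fract const var)
qed

lemma deg_q_finite:
  assumes "r \<noteq> 0"
  shows "deg_q r = ereal (real_of_ereal (deg_q r))"
proof -
  obtain f g where "f \<noteq> 0" "g \<noteq> 0" "r = Fraction_Field.Fract f g"
    using assms by (rule ratfun_nonzero_cases)
  then show ?thesis
    by (simp add: deg_q_Fract)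
qed

lemma ord_q_finite:
  assumes "r \<noteq> 0"
  shows "ord_q r = ereal (real_of_ereal (ord_q r))"
proof -
  obtain f g where "f \<noteq> 0" "g \<noteq> 0" "r = Fraction_Field.Fract f g"
    using assms by (rule ratfun_nonzero_cases)
  then show ?thesis
    by (simp add: ord_q_Fract)
qed

text \<open>At 0 the infinite degree becomes the real number 0, which is harmless since the axioms
  and \<open>val_le\<close> exempt 0.\<close>

interpretation deg: ratfun_valuation "\<lambda>r. real_of_ereal (deg_q r)"
proof (rule ratfun_valuationI[of _ "\<lambda>f. real (degree f)"])
  show "real (degree (f + g)) \<le> max (real (degree f)) (real (degree g))" for f g :: "complex poly"
    using degree_add_le_max[of f g] by linarith
qed (simp_all add: deg_q_Fract degree_mult_eq)

interpretation ord: ratfun_valuation "\<lambda>r. - real_of_ereal (ord_q r)"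
proof (rule ratfun_valuationI[of _ "\<lambda>f. - real (order 0 f)"])
  show "- real (order 0 (f + g)) \<le> max (- real (order 0 f)) (- real (order 0 g))"
    if "f \<noteq> 0" "g \<noteq> 0" "f + g \<noteq> 0" for f g :: "complex poly"
    using order_add_ge[OF that, of 0] by linarith
  show "- real (order 0 [:0, 1 :: complex:]) \<noteq> 0"
    using order_power_n_n[of "0 :: complex" 1] by simp
qed (simp_all add: ord_q_Fract order_mult order_0I)

text \<open>The order estimate adds the s' term, where the informal statement subtracts it: y(qx) =
  1 + q x y(x) has a solution with \<open>ord_q\<close> of the coefficients equal to -h(h-1)/2, so
  subtracting would fail for every s' >= 0.\<close>

theorem theorem1:
  fixes n :: nat and F :: qpoly and y :: "ratfun fps"
  assumes F_nonzero: "F \<noteq> 0"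
    and F_vars: "qpoly_vars F \<subseteq> {Q, X} \<union> W ` {..n}"
    and solution: "qpoly_eval (q_assign y) F = 0"
  shows "\<exists>s s' :: real. s \<ge> 0 \<and> s' \<ge> 0 \<and>
    limsup (\<lambda>h. ereal (1 / real h) *
      (deg_q (fps_nth y h) - ereal (s * (real h * (real h - 1) / 2)))) < \<infinity> \<and>
    limsup (\<lambda>h. ereal (1 / real h) *
      (ord_q (fps_nth y h) + ereal (s' * (real h * (real h - 1) / 2)))) > - \<infinity>"
proof -
  obtain C where C: "C \<ge> 0" "\<And>h. h \<ge> 1 \<Longrightarrow> deg.val_le (fps_nth y h) (C * (real h)\<^sup>2)"
    using deg.val_solution_quadratic[OF assms] by blast
  obtain C' where C': "C' \<ge> 0" "\<And>h. h \<ge> 1 \<Longrightarrow> ord.val_le (fps_nth y h) (C' * (real h)\<^sup>2)"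
    using ord.val_solution_quadratic[OF assms] by blast
  \<comment> \<open>With s = 2c the subtracted term is c h^2 - c h, which leaves at most c h.
    Applied to the degree and to minus the order.\<close>
  have scale: "1 / real h * (t - 2 * c * (real h * (real h - 1) / 2)) \<le> c"
    if "h \<ge> 1" "t \<le> c * (real h)\<^sup>2" for h t c
    using that by (simp add: field_simps power2_eq_square)
  have "limsup (\<lambda>h. ereal (1 / real h) *
      (deg_q (fps_nth y h) - ereal (2 * C * (real h * (real h - 1) / 2)))) \<le> ereal C"
  proof (rule Limsup_bounded, rule eventually_sequentiallyI)
    fix h :: nat assume "h \<ge> 1"
    show "ereal (1 / real h) *
        (deg_q (fps_nth y h) - ereal (2 * C * (real h * (real h - 1) / 2))) \<le> ereal C"
    proof (cases "fps_nth y h = 0")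
      case True
      then show ?thesis
        using \<open>h \<ge> 1\<close> by (simp add: deg_q_def)
    next
      case False
      then have "real_of_ereal (deg_q (fps_nth y h)) \<le> C * (real h)\<^sup>2"
        using C(2)[OF \<open>h \<ge> 1\<close>] by (simp add: deg.val_le_def)
      from scale[OF \<open>h \<ge> 1\<close> this] show ?thesis
        by (subst deg_q_finite[OF False]) (simp only: ereal_minus times_ereal.simps ereal_less_eq)
    qed
  qed
  moreover have "ereal (- C') \<le> limsup (\<lambda>h. ereal (1 / real h) *
      (ord_q (fps_nth y h) + ereal (2 * C' * (real h * (real h - 1) / 2))))"
  proof (rule le_Limsup, simp, rule eventually_sequentiallyI)
    fix h :: nat assume "h \<ge> 1"
    show "ereal (- C') \<le> ereal (1 / real h) *
        (ord_q (fps_nth y h) + ereal (2 * C' * (real h * (real h - 1) / 2)))"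
    proof (cases "fps_nth y h = 0")
      case True
      then show ?thesis
        using \<open>h \<ge> 1\<close> by (simp add: ord_q_def)
    next
      case False
      then have "- real_of_ereal (ord_q (fps_nth y h)) \<le> C' * (real h)\<^sup>2"
        using C'(2)[OF \<open>h \<ge> 1\<close>] by (simp add: ord.val_le_def)
      from scale[OF \<open>h \<ge> 1\<close> this] have
        "- C' \<le> 1 / real h * (real_of_ereal (ord_q (fps_nth y h)) + 2 * C' * (real h * (real h - 1) / 2))"
        using \<open>h \<ge> 1\<close> by (simp add: field_simps)
      then show ?thesis
        by (subst ord_q_finite[OF False]) (simp only: plus_ereal.simps times_ereal.simps ereal_less_eq)
    qed
  qed
  ultimately show ?thesis
    using C(1) C'(1) by (intro exI[of _ "2 * C"] exI[of _ "2 * C'"]) (auto intro: le_less_trans less_le_trans)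
qed

end
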